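(* Let $A_1,\dots,A_n,B$ be real symmetric matrices of the same order and $c\in\mathbb{R}^n$. Consider $$(SDP)\quad \min\Big\{\sum_{i=1}^n c_ix_i:\ \sum_{i=1}^n A_ix_i\succeq B,\ x\in\mathbb{R}^n\Big\}$$ and $$(DSDP)\quad \max\big\{B\cdot Y:\ A_i\cdot Y=c_i\ \forall i\in\{1,\dots,n\},\ Y\succeq 0\big\}.$$ If both $(SDP)$ and $(DSDP)$ are strictly feasible, then their optimal values are equal and this value is reached by both programs.
   Context: $M\succeq N$ means that $M-N$ is symmetric positive semidefinite, $M\succ N$ that $M-N$ is symmetric positive definite; $M\cdot N=\sum_{i,j}M_{ij}N_{ij}$. The variable $Y$ is a real symmetric matrix. $(SDP)$ is strictly feasible if some $x\in\mathbb{R}^n$ satisfies $\sum_{i=1}^n A_ix_i\succ B$; $(DSDP)$ is strictly feasible if some $Y\succ 0$ satisfies $A_i\cdot Y=c_i$ for all $i$. *)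

theory Defs
  imports "HOL-Analysis.Analysis"
begin

definition symmetric_mat :: "real ^ 'm ^ 'm \<Rightarrow> bool" where
  "symmetric_mat M \<longleftrightarrow> transpose M = M"

definition pos_semidef :: "real ^ 'm ^ 'm \<Rightarrow> bool" where
  "pos_semidef M \<longleftrightarrow> symmetric_mat M \<and> (\<forall>v. 0 \<le> v \<bullet> (M *v v))"

definition pos_def :: "real ^ 'm ^ 'm \<Rightarrow> bool" where
  "pos_def M \<longleftrightarrow> symmetric_mat M \<and> (\<forall>v. v \<noteq> 0 \<longrightarrow> 0 < v \<bullet> (M *v v))"

definition loewner_ge :: "real ^ 'm ^ 'm \<Rightarrow> real ^ 'm ^ 'm \<Rightarrow> bool" (infix "\<succeq>" 50) where
  "M \<succeq> N \<longleftrightarrow> pos_semidef (M - N)"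

definition loewner_gt :: "real ^ 'm ^ 'm \<Rightarrow> real ^ 'm ^ 'm \<Rightarrow> bool" (infix "\<succ>" 50) where
  "M \<succ> N \<longleftrightarrow> pos_def (M - N)"

text \<open>
  The library inner product on \<^typ>\<open>real ^ 'm ^ 'm\<close> is the sum of the products of
  corresponding entries, so it serves as the product of matrices in both programs.
\<close>

lemma matrix_inner_eq_sum:
  fixes M N :: "real ^ 'm ^ 'm"
  shows "M \<bullet> N = (\<Sum>i\<in>UNIV. \<Sum>j\<in>UNIV. M $ i $ j * N $ i $ j)"
  by (simp add: inner_vec_def)

definition lin_comb :: "('n::finite \<Rightarrow> real ^ 'm ^ 'm) \<Rightarrow> real ^ 'n \<Rightarrow> real ^ 'm ^ 'm" where
  "lin_comb A x = (\<Sum>i\<in>UNIV. (x $ i) *\<^sub>R A i)"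

definition sdp_objective :: "real ^ 'n \<Rightarrow> real ^ 'n \<Rightarrow> real" where
  "sdp_objective c x = (\<Sum>i\<in>UNIV. c $ i * x $ i)"

definition sdp_feasible :: "('n::finite \<Rightarrow> real ^ 'm ^ 'm) \<Rightarrow> real ^ 'm ^ 'm \<Rightarrow> (real ^ 'n) set" where
  "sdp_feasible A B = {x. lin_comb A x \<succeq> B}"

definition dsdp_feasible :: "('n::finite \<Rightarrow> real ^ 'm ^ 'm) \<Rightarrow> real ^ 'n \<Rightarrow> (real ^ 'm ^ 'm) set" where
  "dsdp_feasible A c = {Y. (\<forall>i. A i \<bullet> Y = c $ i) \<and> Y \<succeq> 0}"

definition sdp_strictly_feasible :: "('n::finite \<Rightarrow> real ^ 'm ^ 'm) \<Rightarrow> real ^ 'm ^ 'm \<Rightarrow> bool" where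
  "sdp_strictly_feasible A B \<longleftrightarrow> (\<exists>x. lin_comb A x \<succ> B)"

definition dsdp_strictly_feasible :: "('n::finite \<Rightarrow> real ^ 'm ^ 'm) \<Rightarrow> real ^ 'n \<Rightarrow> bool" where
  "dsdp_strictly_feasible A c \<longleftrightarrow> (\<exists>Y. Y \<succ> 0 \<and> (\<forall>i. A i \<bullet> Y = c $ i))"

text \<open>
  Optimal values are taken in the extended reals, so that an infeasible or unbounded
  program gets an infinite value instead of an unspecified real number.
\<close>

definition sdp_value ::
  "('n::finite \<Rightarrow> real ^ 'm ^ 'm) \<Rightarrow> real ^ 'm ^ 'm \<Rightarrow> real ^ 'n \<Rightarrow> ereal" where
  "sdp_value A B c = (INF x \<in> sdp_feasible A B. ereal (sdp_objective c x))"

definition dsdp_value ::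
  "('n::finite \<Rightarrow> real ^ 'm ^ 'm) \<Rightarrow> real ^ 'm ^ 'm \<Rightarrow> real ^ 'n \<Rightarrow> ereal" where
  "dsdp_value A B c = (SUP Y \<in> dsdp_feasible A c. ereal (B \<bullet> Y))"

end

theory Submission
  imports Defs
begin

text \<open>
  A positive definite \<open>N\<close> has positive inner product with every nonzero positive semidefinite \<open>M\<close>:
  a Cholesky step splits off a rank one summand of \<open>M\<close>, and one inducts on the dimension of
  the kernel. Hence, for a strictly feasible dual \<open>Y\<close>, the objective \<open>c \<bullet> x\<close>, which differs
  by a constant from the inner product of the slack \<open>lin_comb A x - B\<close> with \<open>Y\<close>, controls the
  norm of the slack, and the primal minimum \<open>p\<close> is attained by compactness. The slacks with
  \<open>c \<bullet> x < p\<close> miss the cone of positive semidefinite matrices. A separating hyperplane is given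
  by a nonzero positive semidefinite matrix, whose inner products with the \<open>A i\<close> are proportional
  to \<open>c\<close>; primal strict feasibility makes the factor positive, and rescaling gives a dual
  optimum of value \<open>p\<close>.
\<close>

subsection \<open>Positive semidefinite matrices\<close>

definition outer :: "real ^ 'm \<Rightarrow> real ^ 'm ^ 'm" where
  "outer w = (\<chi> i j. w $ i * w $ j)"

lemma outer_mult_vec: "outer w *v u = (w \<bullet> u) *\<^sub>R w"
  by (simp add: outer_def matrix_vector_mult_def vec_eq_iff inner_vec_def sum_distrib_left
      sum_distrib_right mult_ac)

lemma symmetric_outer: "symmetric_mat (outer w)"
  by (simp add: symmetric_mat_def outer_def transpose_def vec_eq_iff mult.commute)

lemma inner_outer: "outer w \<bullet> N = w \<bullet> (N *v w)"
  by (simp add: outer_def matrix_vector_mult_def inner_vec_def sum_distrib_left mult_ac)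

lemma pos_semidef_outer: "pos_semidef (outer w)"
  by (simp add: pos_semidef_def symmetric_outer outer_mult_vec inner_commute)

lemma symmetric_mat_diff: "symmetric_mat M \<Longrightarrow> symmetric_mat N \<Longrightarrow> symmetric_mat (M - N)"
  by (simp add: symmetric_mat_def transpose_def vec_eq_iff)

lemma symmetric_mat_scaleR: "symmetric_mat M \<Longrightarrow> symmetric_mat (a *\<^sub>R M)"
  by (simp add: symmetric_mat_def transpose_def vec_eq_iff)

lemma symmetric_mat_lin_comb:
  assumes "\<And>i. symmetric_mat (A i)"
  shows "symmetric_mat (lin_comb A x)"
  using assms by (simp add: symmetric_mat_def lin_comb_def transpose_def vec_eq_iff)

lemma pos_semidef_scaleR: "pos_semidef M \<Longrightarrow> 0 \<le> a \<Longrightarrow> pos_semidef (a *\<^sub>R M)"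
  by (simp add: pos_semidef_def symmetric_mat_scaleR scaleR_matrix_vector_assoc[symmetric])

lemma pos_def_imp_pos_semidef: "pos_def M \<Longrightarrow> pos_semidef M"
  unfolding pos_def_def pos_semidef_def
  by (metis inner_zero_left less_eq_real_def)

lemma symmetric_mat_inner:
  assumes "symmetric_mat M"
  shows "u \<bullet> (M *v v) = v \<bullet> (M *v u)"
  using assms unfolding symmetric_mat_def
  by (metis dot_lmul_matrix inner_commute transpose_matrix_vector)

text \<open>Polarization: by symmetry the form at \<open>u + v\<close> exceeds the sum of those at
  \<open>u\<close> and \<open>v\<close> by twice the mixed term, so all mixed terms vanish.\<close>

lemma symmetric_mat_zeroI:
  assumes sym: "symmetric_mat M" and zero: "\<And>v. v \<bullet> (M *v v) = 0"
  shows "M = 0"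
proof -
  have "u \<bullet> (M *v v) = 0" for u v
    using zero[of "u + v"] zero[of u] zero[of v] symmetric_mat_inner[OF sym, of u v]
    by (simp add: matrix_vector_right_distrib inner_add)
  then have "M *v v = 0" for v
    by (metis inner_eq_zero_iff)
  then show ?thesis
    by (metis matrix_eq matrix_vector_mult_0)
qed

text \<open>One step of a Cholesky decomposition; the vector \<open>v\<close> joins the kernel.\<close>

lemma pos_semidef_deflate:
  fixes M :: "real ^ 'm::finite ^ 'm"
  assumes psd: "pos_semidef M" and pos: "0 < v \<bullet> (M *v v)"
  defines "M' \<equiv> M - (1 / (v \<bullet> (M *v v))) *\<^sub>R outer (M *v v)"
  shows "pos_semidef M'" and "dim {u. M *v u = 0} < dim {u. M' *v u = 0}"
proof -
  let ?q = "v \<bullet> (M *v v)"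
  have sym: "symmetric_mat M"
    using psd by (simp add: pos_semidef_def)
  have mult: "M' *v u = M *v u - ((v \<bullet> (M *v u)) / ?q) *\<^sub>R (M *v v)" for u
    using symmetric_mat_inner[OF sym, of u v]
    by (simp add: M'_def matrix_vector_mult_diff_rdistrib scaleR_matrix_vector_assoc[symmetric]
        outer_mult_vec inner_commute)
  have "0 \<le> u \<bullet> (M' *v u)" for u
  proof -
    \<comment> \<open>Completing the square: the form of \<open>M'\<close> at \<open>u\<close> is
      the form of \<open>M\<close> at \<open>u - ?s *\<^sub>R v\<close>.\<close>
    let ?s = "(v \<bullet> (M *v u)) / ?q"
    have "0 \<le> (u - ?s *\<^sub>R v) \<bullet> (M *v (u - ?s *\<^sub>R v))"
      using psd by (simp add: pos_semidef_def)
    also have "\<dots> = u \<bullet> (M *v u) - 2 * ?s * (v \<bullet> (M *v u)) + ?s * (?s * ?q)"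
      using symmetric_mat_inner[OF sym, of u v]
      by (simp add: matrix_vector_mult_diff_distrib matrix_vector_mult_scaleR inner_diff
          algebra_simps del: times_divide_eq_left times_divide_eq_right)
    also have "?s * ?q = v \<bullet> (M *v u)"
      using pos by simp
    finally show ?thesis
      using symmetric_mat_inner[OF sym, of u v] by (simp add: mult inner_diff_right)
  qed
  moreover have "symmetric_mat M'"
    unfolding M'_def by (intro symmetric_mat_diff symmetric_mat_scaleR sym symmetric_outer)
  ultimately show "pos_semidef M'"
    by (simp add: pos_semidef_def)
  have sub: "subspace {u. N *v u = 0}" for N :: "real ^ 'm ^ 'm"
    by (simp add: subspace_def matrix_vector_right_distrib matrix_vector_mult_scaleR)
  have "M *v v \<noteq> 0" "M' *v v = 0"
    using pos by (auto simp: mult)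
  moreover have "M' *v u = 0" if "M *v u = 0" for u
    using that by (simp add: mult)
  ultimately have "{u. M *v u = 0} \<subset> {u. M' *v u = 0}"
    by blast
  then show "dim {u. M *v u = 0} < dim {u. M' *v u = 0}"
    by (metis dim_psubset span_eq_iff sub)
qed

lemma inner_pos:
  fixes M N :: "real ^ 'm::finite ^ 'm"
  assumes "pos_semidef M" "M \<noteq> 0" "pos_def N"
  shows "0 < M \<bullet> N"
  using assms(1,2)
proof (induction "DIM(real ^ 'm) - dim {u. M *v u = 0}" arbitrary: M rule: less_induct)
  case less
  obtain v where pos: "0 < v \<bullet> (M *v v)"
    using less.prems symmetric_mat_zeroI[of M] unfolding pos_semidef_def
    by (metis less_eq_real_def)
  let ?q = "v \<bullet> (M *v v)" and ?w = "M *v v"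
  let ?M' = "M - (1 / ?q) *\<^sub>R outer ?w"
  note deflate = pos_semidef_deflate[OF less.prems(1) pos]
  \<comment> \<open>The kernel grows but stays within the full dimension, so the truncated
    difference serving as induction measure strictly drops.\<close>
  have "dim {u. ?M' *v u = 0} \<le> DIM(real ^ 'm)"
    by (rule dim_subset_UNIV)
  then have "?M' = 0 \<or> 0 < ?M' \<bullet> N"
    using less.hyps[of ?M'] deflate by fastforce
  then have "0 \<le> ?M' \<bullet> N"
    by auto
  moreover have "?w \<noteq> 0"
    using pos by auto
  then have "0 < (1 / ?q) * (outer ?w \<bullet> N)"
    using assms(3) pos by (simp add: inner_outer pos_def_def)
  ultimately show ?case
    by (simp add: inner_diff_left)
qed

text \<open>Adding a small multiple of the identity to \<open>N\<close> makes it positive definite,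
  so \<open>inner_pos\<close> applies up to an arbitrarily small error.\<close>

lemma inner_nonneg:
  fixes M N :: "real ^ 'm::finite ^ 'm"
  assumes M: "pos_semidef M" and N: "pos_semidef N"
  shows "0 \<le> M \<bullet> N"
proof (rule field_le_epsilon)
  fix e :: real
  assume "0 < e"
  \<comment> \<open>The perturbation then costs at most \<open>e\<close>; the added 1 keeps the
    denominator positive.\<close>
  define d where "d = e / (\<bar>M \<bullet> mat 1\<bar> + 1)"
  have d: "0 < d"
    using \<open>0 < e\<close> by (simp add: d_def)
  have "symmetric_mat (N + d *\<^sub>R mat 1)"
    using N by (simp add: pos_semidef_def symmetric_mat_def transpose_def mat_def vec_eq_iff)
  then have "pos_def (N + d *\<^sub>R mat 1)"
    using N d by (auto simp: pos_def_def pos_semidef_def matrix_vector_mult_add_rdistrib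
        scaleR_matrix_vector_assoc[symmetric] inner_add_right intro!: add_nonneg_pos)
  then have "0 \<le> M \<bullet> (N + d *\<^sub>R mat 1)"
    using inner_pos[OF M] by (cases "M = 0") force+
  also have "\<dots> \<le> M \<bullet> N + d * (\<bar>M \<bullet> mat 1\<bar> + 1)"
    using d by (simp add: inner_add_right)
  also have "d * (\<bar>M \<bullet> mat 1\<bar> + 1) = e"
    by (simp add: d_def add_nonneg_eq_0_iff)
  finally show "0 \<le> M \<bullet> N + e" .
qed

lemma closed_pos_semidef: "closed {M :: real ^ 'm::finite ^ 'm. pos_semidef M}"
proof -
  \<comment> \<open>Every condition is linear in \<open>M\<close>: the form at \<open>v\<close> is
    the pairing with \<open>outer v\<close>.\<close>
  have eq: "{M :: real ^ 'm ^ 'm. pos_semidef M} =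
      (\<Inter>i j. {M. M $ j $ i = M $ i $ j}) \<inter> (\<Inter>v. {M. 0 \<le> outer v \<bullet> M})"
    by (auto simp: pos_semidef_def symmetric_mat_def transpose_def vec_eq_iff inner_outer)
  show ?thesis
    unfolding eq
    by (intro closed_Int closed_INT ballI closed_Collect_eq closed_Collect_le continuous_intros)
qed

text \<open>The constant is the minimum of the pairing over the compact set of positive semidefinite
  matrices of norm 1, positive by \<open>inner_pos\<close>; homogeneity does the rest.\<close>

lemma pos_def_coercive:
  fixes N :: "real ^ 'm::finite ^ 'm"
  assumes "pos_def N"
  obtains d where "0 < d" "\<And>M. pos_semidef M \<Longrightarrow> d * norm M \<le> M \<bullet> N"
proof -
  let ?S = "{M :: real ^ 'm ^ 'm. pos_semidef M} \<inter> sphere 0 1"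
  have "compact ?S"
    using closed_pos_semidef compact_sphere by (rule closed_Int_compact)
  moreover have "continuous_on ?S (\<lambda>M. M \<bullet> N)"
    by (intro continuous_intros)
  ultimately obtain d where d: "0 < d" "\<And>M. M \<in> ?S \<Longrightarrow> d \<le> M \<bullet> N"
  proof (cases "?S = {}")
    case True
    then show ?thesis
      using that[of 1] by (metis empty_iff zero_less_one)
  next
    case False
    then obtain M0 where M0: "M0 \<in> ?S" "\<And>M. M \<in> ?S \<Longrightarrow> M0 \<bullet> N \<le> M \<bullet> N"
      using continuous_attains_inf[OF \<open>compact ?S\<close> _ \<open>continuous_on ?S (\<lambda>M. M \<bullet> N)\<close>] by blast
    have "0 < M0 \<bullet> N"
      using M0(1) assms by (intro inner_pos) auto
    then show ?thesis
      using that M0(2) by blast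
  qed
  show thesis
  proof (rule that[OF d(1)])
    fix M :: "real ^ 'm ^ 'm"
    assume M: "pos_semidef M"
    show "d * norm M \<le> M \<bullet> N"
    proof (cases "M = 0")
      case False
      then have "(1 / norm M) *\<^sub>R M \<in> ?S"
        using M by (simp add: pos_semidef_scaleR)
      from d(2)[OF this] show ?thesis
        using False by (simp add: field_simps)
    qed simp
  qed
qed

subsection \<open>Duality\<close>

lemma sdp_objective_inner: "sdp_objective c x = c \<bullet> x"
  by (simp add: sdp_objective_def inner_vec_def)

lemma inner_lin_comb: "lin_comb A x \<bullet> Y = (\<chi> i. A i \<bullet> Y) \<bullet> x"
  by (simp add: lin_comb_def inner_sum_left inner_vec_def[of "vec_lambda _"] mult.commute)

lemma linear_lin_comb: "linear (lin_comb A)"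
  by (rule linearI)
    (simp_all add: lin_comb_def scaleR_add_left sum.distrib scaleR_sum_right)

lemma dual_gap:
  assumes "\<And>i. A i \<bullet> Y = c $ i"
  shows "c \<bullet> x - B \<bullet> Y = (lin_comb A x - B) \<bullet> Y"
  using assms by (simp add: inner_diff_left inner_lin_comb)

lemma weak_duality:
  assumes "x \<in> sdp_feasible A B" "Y \<in> dsdp_feasible A c"
  shows "B \<bullet> Y \<le> c \<bullet> x"
  using assms inner_nonneg[of "lin_comb A x - B" Y] dual_gap[of A Y c x B]
  by (simp add: sdp_feasible_def dsdp_feasible_def loewner_ge_def)

lemma sdp_attained:
  fixes A :: "'n::finite \<Rightarrow> real ^ 'm::finite ^ 'm"
  assumes "sdp_feasible A B \<noteq> {}" and "dsdp_strictly_feasible A c"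
  obtains x where "x \<in> sdp_feasible A B" "\<And>z. z \<in> sdp_feasible A B \<Longrightarrow> c \<bullet> x \<le> c \<bullet> z"
proof -
  obtain Y where Y: "pos_def Y" "\<And>i. A i \<bullet> Y = c $ i"
    using assms(2) by (auto simp: dsdp_strictly_feasible_def loewner_gt_def)
  note gap = dual_gap[of A Y c _ B, OF Y(2)]
  obtain d where d: "0 < d" "\<And>M. pos_semidef M \<Longrightarrow> d * norm M \<le> M \<bullet> Y"
    using pos_def_coercive[OF Y(1)] by blast
  obtain x1 where x1: "x1 \<in> sdp_feasible A B"
    using assms(1) by blast
  \<comment> \<open>The feasible \<open>x\<close> need not be bounded at a given objective level, because the \<open>A i\<close> may be
    linearly dependent; the slack matrices are.\<close>
  define r where "r = (lin_comb A x1 - B) \<bullet> Y / d"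
  let ?S = "((\<lambda>M. M - B) ` range (lin_comb A) \<inter> {M. pos_semidef M}) \<inter> cball 0 r"
  have "closed (range (lin_comb A))"
    by (intro closed_subspace linear_subspace_image linear_lin_comb subspace_UNIV)
  then have "closed ((\<lambda>M. M - B) ` range (lin_comb A))"
    using closed_translation[of "range (lin_comb A)" "- B"] by simp
  then have "compact ?S"
    using closed_pos_semidef by (intro closed_Int_compact closed_Int compact_cball)
  \<comment> \<open>By \<open>gap\<close>, not exceeding the objective of \<open>x1\<close> means
    not exceeding the pairing of its slack with \<open>Y\<close>; coercivity turns this into a norm
    bound.\<close>
  moreover have bound: "norm (lin_comb A x - B) \<le> r"
    if "x \<in> sdp_feasible A B" "c \<bullet> x \<le> c \<bullet> x1" for x
    using d(2)[of "lin_comb A x - B"] d(1) that gap[of x] gap[of x1]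
    by (simp add: r_def sdp_feasible_def loewner_ge_def field_simps)
  then have "lin_comb A x1 - B \<in> ?S"
    using x1 by (auto simp: sdp_feasible_def loewner_ge_def)
  ultimately obtain M where M: "M \<in> ?S" "\<And>N. N \<in> ?S \<Longrightarrow> M \<bullet> Y \<le> N \<bullet> Y"
    using continuous_attains_inf[of ?S "\<lambda>M. M \<bullet> Y"] by (force intro: continuous_intros)
  then obtain x where x: "M = lin_comb A x - B"
    by blast
  show thesis
  proof (rule that)
    show "x \<in> sdp_feasible A B"
      using M(1) x by (simp add: sdp_feasible_def loewner_ge_def)
    fix z
    assume z: "z \<in> sdp_feasible A B"
    have *: "c \<bullet> x \<le> c \<bullet> z'" if "z' \<in> sdp_feasible A B" "c \<bullet> z' \<le> c \<bullet> x1" for z'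
      using M(2)[of "lin_comb A z' - B"] that bound[OF that] gap[of x] gap[of z'] x
      by (auto simp: sdp_feasible_def loewner_ge_def)
    \<comment> \<open>A point \<open>z\<close> with a larger objective than \<open>x1\<close> is
      handled by comparing through \<open>x1\<close>.\<close>
    show "c \<bullet> x \<le> c \<bullet> z"
      using *[OF z] *[OF x1] by linarith
  qed
qed

text \<open>A component of \<open>a\<close> orthogonal to \<open>c\<close> would be unbounded on the
  halfspace, and a negative multiple of \<open>c\<close> would blow up as
  \<open>c \<bullet> x\<close> decreases; letting \<open>c \<bullet> x\<close> tend to
  \<open>p\<close> gives the last bound.\<close>

lemma halfspace_bound_imp_multiple:
  fixes a c :: "'a::real_inner"
  assumes "c \<noteq> 0" and bound: "\<And>x. c \<bullet> x < p \<Longrightarrow> a \<bullet> x \<le> b"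
  obtains t where "0 \<le> t" "a = t *\<^sub>R c" "t * p \<le> b"
proof -
  define t where "t = (a \<bullet> c) / (c \<bullet> c)"
  define w where "w = a - t *\<^sub>R c"
  have cc: "0 < c \<bullet> c"
    using assms(1) by simp
  then have wc: "c \<bullet> w = 0"
    by (simp add: w_def t_def inner_diff_right inner_commute)
  have point: "t * q + s * (w \<bullet> w) \<le> b" if "q < p" for q s
  proof -
    \<comment> \<open>The first term fixes the level \<open>q\<close>; the second moves freely along
      the part of \<open>a\<close> orthogonal to \<open>c\<close>.\<close>
    let ?x = "(q / (c \<bullet> c)) *\<^sub>R c + s *\<^sub>R w"
    have "c \<bullet> ?x = q"
      using cc wc by (simp add: inner_add_right)
    moreover have "a \<bullet> ?x = t * (c \<bullet> ?x) + w \<bullet> ?x"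
      by (simp add: w_def inner_diff_left)
    moreover have "w \<bullet> ?x = s * (w \<bullet> w)"
      using wc by (simp add: inner_add_right inner_commute)
    ultimately show ?thesis
      using bound[of ?x] that by simp
  qed
  have "w = 0"
  proof (rule ccontr)
    assume "w \<noteq> 0"
    then show False
      using point[of "p - 1" "(b - t * (p - 1) + 1) / (w \<bullet> w)"] by simp
  qed
  moreover have "0 \<le> t"
  proof (rule ccontr)
    assume "\<not> 0 \<le> t"
    \<comment> \<open>This level is below \<open>p\<close> and so low that its product with the
      negative \<open>t\<close> reaches \<open>b + 1\<close>.\<close>
    then have "b + 1 \<le> t * min (p - 1) ((b + 1) / t)"
      using mult_left_mono_neg[of "min (p - 1) ((b + 1) / t)" "(b + 1) / t" t] by simp
    then show False
      using point[of "min (p - 1) ((b + 1) / t)" 0] by (simp add: min_less_iff_disj)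
  qed
  moreover have "t * p \<le> b"
  proof (rule field_le_epsilon)
    fix e :: real
    assume "0 < e"
    have "t * (p - e / (t + 1)) \<le> b"
      using point[of "p - e / (t + 1)" 0] \<open>0 < e\<close> \<open>0 \<le> t\<close> by simp
    moreover have "t * (e / (t + 1)) \<le> e"
      using \<open>0 < e\<close> \<open>0 \<le> t\<close> by (simp add: field_simps)
    ultimately show "t * p \<le> b + e"
      by (simp add: right_diff_distrib)
  qed
  ultimately show thesis
    using that by (simp add: w_def)
qed

text \<open>The normal of a separating hyperplane pairs nonnegatively with the cone; testing it on
  the matrices \<open>outer v\<close> makes its form nonnegative.\<close>

lemma pos_semidef_separation:
  fixes C :: "(real ^ 'm::finite ^ 'm) set"
  assumes "convex C" "C \<noteq> {}" and sym: "\<And>M. M \<in> C \<Longrightarrow> symmetric_mat M"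
    and disj: "\<And>M. M \<in> C \<Longrightarrow> \<not> pos_semidef M"
  obtains Y where "pos_semidef Y" "Y \<noteq> 0" "\<And>M. M \<in> C \<Longrightarrow> M \<bullet> Y \<le> 0"
proof -
  \<comment> \<open>Symmetry is dropped here so that the separating matrix is forced to be symmetric;
    for the cone of symmetric matrices it could be any antisymmetric one.\<close>
  define K where "K = {M :: real ^ 'm ^ 'm. \<forall>v. 0 \<le> v \<bullet> (M *v v)}"
  have "convex K"
    by (auto simp: K_def convex_def matrix_vector_mult_add_rdistrib
        scaleR_matrix_vector_assoc[symmetric] inner_add_right)
  moreover have "0 \<in> K"
    by (simp add: K_def)
  moreover have "C \<inter> K = {}"
    using sym disj by (auto simp: K_def pos_semidef_def)
  ultimately obtain Y b where Y: "Y \<noteq> 0" "\<And>M. M \<in> C \<Longrightarrow> Y \<bullet> M \<le> b" "\<And>M. M \<in> K \<Longrightarrow> b \<le> Y \<bullet> M"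
    using separating_hyperplane_sets[of C K] assms(1,2) by blast
  have "b \<le> 0"
    using Y(3)[OF \<open>0 \<in> K\<close>] by simp
  have nonneg: "0 \<le> Y \<bullet> M" if "M \<in> K" for M
  proof (rule ccontr)
    assume "\<not> 0 \<le> Y \<bullet> M"
    moreover have "s *\<^sub>R M \<in> K" if "0 \<le> s" for s
      using \<open>M \<in> K\<close> that by (simp add: K_def scaleR_matrix_vector_assoc[symmetric])
    \<comment> \<open>Scaling \<open>M\<close> by a nonnegative factor brings the pairing to
      \<open>b - 1\<close>, below the bound on \<open>K\<close>.\<close>
    ultimately show False
      using Y(3)[of "((b - 1) / (Y \<bullet> M)) *\<^sub>R M"] \<open>b \<le> 0\<close> by (simp add: divide_nonpos_neg)
  qed
  have "0 \<le> v \<bullet> (Y *v v)" for v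
    using nonneg[of "outer v"] pos_semidef_outer[of v]
    by (simp add: K_def pos_semidef_def inner_outer inner_commute[of Y])
  moreover have "symmetric_mat Y"
  proof -
    \<comment> \<open>The antisymmetric \<open>?D\<close> has zero form, so it lies in
      \<open>K\<close>; but \<open>Y \<bullet> ?D\<close> is minus half the squared norm of
      \<open>?D\<close>.\<close>
    let ?D = "transpose Y - Y"
    have "v \<bullet> (transpose Y *v v) = v \<bullet> (Y *v v)" for v
      by (metis dot_lmul_matrix inner_commute transpose_matrix_vector)
    then have "0 \<le> Y \<bullet> ?D"
      by (intro nonneg) (simp add: K_def matrix_vector_mult_diff_rdistrib inner_diff_right)
    moreover have "transpose Y \<bullet> transpose Y = Y \<bullet> Y"
      unfolding inner_vec_def transpose_def by (simp, subst sum.swap, simp)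
    ultimately have "?D \<bullet> ?D \<le> 0"
      by (simp add: inner_diff inner_commute)
    then have "?D = 0"
      by (metis antisym inner_eq_zero_iff inner_ge_zero)
    then show ?thesis
      by (simp add: symmetric_mat_def)
  qed
  ultimately show thesis
    using that[of Y] Y(1,2) \<open>b \<le> 0\<close> by (force simp: pos_semidef_def inner_commute)
qed

lemma strong_duality:
  fixes A :: "'n::finite \<Rightarrow> real ^ 'm::finite ^ 'm"
  assumes A: "\<And>i. symmetric_mat (A i)" and B: "symmetric_mat B"
    and "sdp_strictly_feasible A B"
    and opt: "\<And>z. z \<in> sdp_feasible A B \<Longrightarrow> p \<le> c \<bullet> z"
  obtains Y where "Y \<in> dsdp_feasible A c" "p \<le> B \<bullet> Y"
proof -
  obtain x0 where x0: "pos_def (lin_comb A x0 - B)"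
    using assms(3) by (auto simp: sdp_strictly_feasible_def loewner_gt_def)
  show thesis
  proof (cases "c = 0")
    case True
    \<comment> \<open>With zero objective, feasibility of \<open>x0\<close> gives
      \<open>p \<le> 0\<close>, and the zero matrix is a dual solution of value 0.\<close>
    have "x0 \<in> sdp_feasible A B"
      using x0 by (simp add: sdp_feasible_def loewner_ge_def pos_def_imp_pos_semidef)
    then show ?thesis
      using opt[of x0] that[of 0] True
      by (simp add: dsdp_feasible_def loewner_ge_def pos_semidef_def symmetric_mat_def
          transpose_def vec_eq_iff)
  next
    case False
    let ?C = "(\<lambda>x. lin_comb A x - B) ` {x. c \<bullet> x < p}"
    have "c \<bullet> (((p - 1) / (c \<bullet> c)) *\<^sub>R c) < p"
      using False by simp
    then have "?C \<noteq> {}"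
      by blast
    moreover have "convex ((\<lambda>M. - B + M) ` lin_comb A ` {x. c \<bullet> x < p})"
      by (intro convex_translation convex_linear_image linear_lin_comb convex_halfspace_lt)
    then have "convex ?C"
      by (simp add: image_image)
    moreover have "\<not> pos_semidef M" if "M \<in> ?C" for M
      using that opt by (force simp: sdp_feasible_def loewner_ge_def)
    moreover have "symmetric_mat M" if "M \<in> ?C" for M
      using that A B by (auto intro: symmetric_mat_diff symmetric_mat_lin_comb)
    ultimately obtain Y where Y: "pos_semidef Y" "Y \<noteq> 0" "\<And>M. M \<in> ?C \<Longrightarrow> M \<bullet> Y \<le> 0"
      using pos_semidef_separation[of ?C] by blast
    have "(\<chi> i. A i \<bullet> Y) \<bullet> x \<le> B \<bullet> Y" if "c \<bullet> x < p" for x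
      using Y(3)[of "lin_comb A x - B"] that by (simp add: inner_diff_left inner_lin_comb)
    then obtain t where t: "0 \<le> t" "(\<chi> i. A i \<bullet> Y) = t *\<^sub>R c" "t * p \<le> B \<bullet> Y"
      using halfspace_bound_imp_multiple[OF False] by metis
    \<comment> \<open>If \<open>t\<close> were 0, all \<open>A i \<bullet> Y\<close> would vanish
      and \<open>B \<bullet> Y\<close> would be nonnegative, so this pairing could not be
      positive.\<close>
    have "0 < (lin_comb A x0 - B) \<bullet> Y"
      using inner_pos[OF Y(1,2) x0] by (simp add: inner_commute)
    then have "t \<noteq> 0"
      using t by (auto simp: inner_diff_left inner_lin_comb)
    then have "0 < t"
      using t(1) by simp
    have "A i \<bullet> Y = t * c $ i" for i
      using t(2) by (metis vec_lambda_beta vector_scaleR_component real_scaleR_def)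
    then have "(1 / t) *\<^sub>R Y \<in> dsdp_feasible A c"
      using Y(1) \<open>0 < t\<close> by (simp add: dsdp_feasible_def loewner_ge_def pos_semidef_scaleR)
    moreover have "p \<le> B \<bullet> ((1 / t) *\<^sub>R Y)"
      using t(3) \<open>0 < t\<close> by (simp add: field_simps)
    ultimately show ?thesis
      by (rule that)
  qed
qed

theorem theorem5:
  fixes A :: "'n::finite \<Rightarrow> real ^ 'm::finite ^ 'm"
    and B :: "real ^ 'm ^ 'm"
    and c :: "real ^ 'n"
  assumes "\<And>i. symmetric_mat (A i)"
    and "symmetric_mat B"
    and "sdp_strictly_feasible A B"
    and "dsdp_strictly_feasible A c"
  shows "sdp_value A B c = dsdp_value A B c \<and>
    (\<exists>x \<in> sdp_feasible A B. ereal (sdp_objective c x) = sdp_value A B c) \<and>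
    (\<exists>Y \<in> dsdp_feasible A c. ereal (B \<bullet> Y) = dsdp_value A B c)"
proof -
  have "sdp_feasible A B \<noteq> {}"
    using assms(3) pos_def_imp_pos_semidef
    unfolding sdp_strictly_feasible_def sdp_feasible_def loewner_gt_def loewner_ge_def by blast
  then obtain x where x: "x \<in> sdp_feasible A B" "\<And>z. z \<in> sdp_feasible A B \<Longrightarrow> c \<bullet> x \<le> c \<bullet> z"
    using sdp_attained assms(4) by blast
  obtain Y where Y: "Y \<in> dsdp_feasible A c" "c \<bullet> x \<le> B \<bullet> Y"
    using strong_duality[OF assms(1-3) x(2)] by blast
  have eq: "B \<bullet> Y = c \<bullet> x"
    using Y weak_duality[OF x(1) Y(1)] by simp
  have "sdp_value A B c = ereal (c \<bullet> x)"
    unfolding sdp_value_def sdp_objective_inner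
    using x by (intro antisym INF_lower INF_greatest) auto
  moreover have "dsdp_value A B c = ereal (c \<bullet> x)"
    unfolding dsdp_value_def
    using Y(1) eq weak_duality[OF x(1)] by (intro antisym SUP_least) (auto intro: SUP_upper2)
  ultimately show ?thesis
    using x(1) Y(1) eq by (auto simp: sdp_objective_inner)
qed

end
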